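(* Let $\mathcal C\subset\mathbb{P}^{n-1}$ be a real polyhedral cone and let $\Gamma$ be any non-redundant external representation of $\mathcal C$ consisting of finitely many half-spaces in $\Sigma$. Then $\mathcal A=\{\text{apex of }\mathcal H:\mathcal H\in\Gamma\}$.
   Context: Max-plus semiring $\mathbb{R}_{\max}=\mathbb{R}\cup\{-\infty\}$ with $\oplus=\max$, $\otimes=+$; on $\mathbb{R}_{\max}^n$, componentwise maximum and $\lambda x=(\lambda+x_1,\dots,\lambda+x_n)$. A real polyhedral cone is $\mathcal C=\{\lambda_1v^1\oplus\dots\oplus\lambda_pv^p:\lambda_r\in\mathbb{R}_{\max}\}$ with $v^1,\dots,v^p\in\mathbb{R}^n$, identified with its image in $\mathbb{P}^{n-1}=\mathbb{R}^n/\mathbb{R}(1,\dots,1)$ (usual topology); $\partial\mathcal C$ is its boundary. For $a\in\mathbb{R}^n$ and non-empty proper $I\subsetneq[n]$, the tropical half-space $\mathcal H(a,I)=\{x\in\mathbb{R}_{\max}^n\setminus\{(-\infty,\dots,-\infty)\}:\max_{i\in I}(x_i-a_i)\ge\max_{j\notin I}(x_j-a_j)\}$ (modulo adding constants) has apex $a\in\mathbb{P}^{n-1}$ and sectors $I$. Let $\Sigma$ be the set of all $\mathcal H(a,I)$ with $\mathcal C\subset\mathcal H(a,I)$ and $a\in\mathcal C$; for $\Gamma\subset\Sigma$ let $\tau(\Gamma)=\{\mathcal H\in\Sigma:\bigcap_{\mathcal H'\in\Gamma}\mathcal H'\subset\mathcal H\}$ ($\tau(\emptyset)=\emptyset$).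 A finite $\Gamma\subset\Sigma$ is a non-redundant external representation of $\mathcal C$ if $\bigcap_{\mathcal H\in\Gamma}\mathcal H=\mathcal C$ and $\mathcal H\notin\tau(\Gamma\setminus\{\mathcal H\})$ for every $\mathcal H\in\Gamma$. For $a\in\partial\mathcal C$ let $\Sigma_a=\{\mathcal H(a,I):\mathcal C\subset\mathcal H(a,I)\}$, and for $X\subset\partial\mathcal C$ let $\tau'(X)=\{a\in\partial\mathcal C:\Sigma_a\subset\tau(\bigcup_{b\in X}\Sigma_b)\}$. $\mathcal A$ denotes the unique finite subset of $\partial\mathcal C$ that is inclusion-minimal among finite sets $X\subset\partial\mathcal C$ with $\tau'(X)=\partial\mathcal C$ (this set exists and is unique). *)

theory Defs
  imports "HOL-Analysis.Analysis"
begin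

section \<open>The projective space \<open>\<real>\<^sup>n / \<real>(1,\<dots>,1)\<close>\<close>

definition same_upto_const :: "real^'n::finite \<Rightarrow> real^'n \<Rightarrow> bool" where
  "same_upto_const x y \<longleftrightarrow> (\<exists>c. \<forall>i. y $ i = c + x $ i)"

lemma equivp_same_upto_const: "equivp (same_upto_const :: real^'n::finite \<Rightarrow> _)"
proof (rule equivpI)
  show "reflp (same_upto_const :: real^'n \<Rightarrow> _)"
    unfolding reflp_def same_upto_const_def by (intro allI exI[of _ 0]) simp
  show "symp (same_upto_const :: real^'n \<Rightarrow> _)"
  proof (rule sympI)
    fix x y :: "real^'n" assume "same_upto_const x y"
    then obtain c where "\<forall>i. y $ i = c + x $ i" unfolding same_upto_const_def by blast
    then have "\<forall>i. x $ i = - c + y $ i" by simp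
    then show "same_upto_const y x" unfolding same_upto_const_def by blast
  qed
  show "transp (same_upto_const :: real^'n \<Rightarrow> _)"
  proof (rule transpI)
    fix x y z :: "real^'n" assume "same_upto_const x y" "same_upto_const y z"
    then obtain c d where "\<forall>i. y $ i = c + x $ i" "\<forall>i. z $ i = d + y $ i"
      unfolding same_upto_const_def by blast
    then have "\<forall>i. z $ i = (d + c) + x $ i" by simp
    then show "same_upto_const x z" unfolding same_upto_const_def by blast
  qed
qed

quotient_type 'n tproj = "real^'n::finite" / same_upto_const
  morphisms rep_tproj proj
  by (rule equivp_same_upto_const)

text \<open>The usual topology is the quotient topology.\<close>

instantiation tproj :: (finite) topological_space
begin

definition open_tproj :: "'a tproj set \<Rightarrow> bool" where
  "open_tproj U \<longleftrightarrow> open (proj -` U)"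

instance
proof
  show "open (UNIV :: 'a tproj set)"
    by (simp add: open_tproj_def)
  show "open (S \<inter> T)" if "open S" "open T" for S T :: "'a tproj set"
    using that by (simp add: open_tproj_def vimage_Int open_Int)
  show "open (\<Union>K)" if "\<forall>S\<in>K. open S" for K :: "'a tproj set set"
    using that by (auto simp: open_tproj_def vimage_Union)
qed

end

section \<open>Max-plus vectors, cones and half-spaces\<close>

text \<open>The max-plus semiring is the set of extended reals different from \<open>\<infinity>\<close>.  Subsets of
  projective space with \<open>-\<infinity>\<close> coordinates allowed are represented by the corresponding subsets of
  \<^term>\<open>rmax_nonzero\<close> that are closed under adding real constants.\<close>

definition rmax_nonzero :: "(ereal^'n::finite) set" where
  "rmax_nonzero = {x. (\<forall>i. x $ i \<noteq> \<infinity>) \<and> (\<exists>i. x $ i \<noteq> -\<infinity>)}"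

definition ereal_vec :: "real^'n::finite \<Rightarrow> ereal^'n" where
  "ereal_vec a = (\<chi> i. ereal (a $ i))"

definition generated_cone :: "nat \<Rightarrow> (nat \<Rightarrow> real^'n::finite) \<Rightarrow> (ereal^'n) set" where
  "generated_cone p v =
    {(\<chi> i. SUP r\<in>{..<p}. l r + ereal (v r $ i)) | l. \<forall>r<p. l r \<noteq> (\<infinity>::ereal)}"

definition real_polyhedral_cone :: "(ereal^'n::finite) set \<Rightarrow> bool" where
  "real_polyhedral_cone C \<longleftrightarrow> (\<exists>p v. C = generated_cone p v)"

text \<open>The image of a cone in projective space.  A point of a real polyhedral cone is either
  real or has all coordinates equal to \<open>-\<infinity>\<close>, and the latter has no image.\<close>

definition proj_image :: "(ereal^'n::finite) set \<Rightarrow> 'n tproj set" where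
  "proj_image C = {proj a | a. ereal_vec a \<in> C}"

definition cone_boundary :: "(ereal^'n::finite) set \<Rightarrow> 'n tproj set" where
  "cone_boundary C = frontier (proj_image C)"

definition halfspace :: "real^'n::finite \<Rightarrow> 'n set \<Rightarrow> (ereal^'n) set" where
  "halfspace a I = {x \<in> rmax_nonzero.
     (MAX i\<in>I. x $ i - ereal (a $ i)) \<ge> (MAX j\<in>- I. x $ j - ereal (a $ j))}"

definition sectors :: "'n::finite set \<Rightarrow> bool" where
  "sectors I \<longleftrightarrow> I \<noteq> {} \<and> I \<noteq> UNIV"

definition apex :: "(ereal^'n::finite) set \<Rightarrow> 'n tproj" where
  "apex H = (THE q. \<exists>a I. sectors I \<and> H = halfspace a I \<and> q = proj a)"

subsection \<open>The apex is well defined\<close>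

lemma mem_halfspace_iff:
  assumes "sectors I"
  shows "x \<in> halfspace a I \<longleftrightarrow> x \<in> rmax_nonzero \<and>
    (\<forall>j. j \<notin> I \<longrightarrow> (\<exists>i\<in>I. x $ j - ereal (a $ j) \<le> x $ i - ereal (a $ i)))"
proof -
  have "I \<noteq> {}" "- I \<noteq> {}" using assms by (auto simp: sectors_def)
  then have "(MAX j\<in>- I. x $ j - ereal (a $ j)) \<le> (MAX i\<in>I. x $ i - ereal (a $ i)) \<longleftrightarrow>
      (\<forall>j\<in>- I. x $ j - ereal (a $ j) \<le> (MAX i\<in>I. x $ i - ereal (a $ i)))"
    by (subst Max_le_iff) simp_all
  also have "\<dots> \<longleftrightarrow> (\<forall>j\<in>- I. \<exists>i\<in>I. x $ j - ereal (a $ j) \<le> x $ i - ereal (a $ i))"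
    using \<open>I \<noteq> {}\<close> by (simp add: Max_ge_iff)
  finally show ?thesis
    unfolding halfspace_def by blast
qed

lemma halfspace_subset_apex_le:
  assumes I: "sectors I" and J: "sectors J" and sub: "halfspace a I \<subseteq> halfspace b J"
    and i: "i \<in> I" and j: "j \<notin> I"
  shows "i \<in> J" and "j \<notin> J \<Longrightarrow> a $ j - b $ j \<le> a $ i - b $ i"
proof -
  define e :: "ereal^'a" where "e = (\<chi> k. if k = i then 0 else -\<infinity>)"
  have "e \<in> rmax_nonzero"
    by (auto simp: e_def rmax_nonzero_def)
  moreover have "\<exists>k\<in>I. e $ l - ereal (a $ l) \<le> e $ k - ereal (a $ k)" if "l \<notin> I" for l
    using that i by (intro bexI[of _ i]) (auto simp: e_def)
  ultimately have "e \<in> halfspace a I"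
    using I by (simp add: mem_halfspace_iff)
  then have eJ: "\<forall>l. l \<notin> J \<longrightarrow> (\<exists>k\<in>J. e $ l - ereal (b $ l) \<le> e $ k - ereal (b $ k))"
    using sub J by (auto simp: mem_halfspace_iff)
  show iJ: "i \<in> J"
  proof (rule ccontr)
    assume "i \<notin> J"
    then obtain k where "k \<in> J" "e $ i - ereal (b $ i) \<le> e $ k - ereal (b $ k)" using eJ by blast
    with \<open>i \<notin> J\<close> show False by (auto simp: e_def zero_ereal_def split: if_splits)
  qed
  assume jJ: "j \<notin> J"
  define x :: "ereal^'a" where
    "x = (\<chi> k. if k = i then ereal (a $ i) else if k = j then ereal (a $ j) else -\<infinity>)"
  have "i \<noteq> j" using i j by auto
  have "x \<in> rmax_nonzero"
    by (auto simp: x_def rmax_nonzero_def)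
  moreover have "\<exists>k\<in>I. x $ l - ereal (a $ l) \<le> x $ k - ereal (a $ k)" if "l \<notin> I" for l
    using that i by (intro bexI[of _ i]) (auto simp: x_def)
  ultimately have "x \<in> halfspace a I"
    using I by (simp add: mem_halfspace_iff)
  then have "x \<in> halfspace b J" using sub by blast
  then obtain k where "k \<in> J" "x $ j - ereal (b $ j) \<le> x $ k - ereal (b $ k)"
    using jJ unfolding mem_halfspace_iff[OF J] by blast
  then show "a $ j - b $ j \<le> a $ i - b $ i"
    using \<open>i \<noteq> j\<close> jJ by (auto simp: x_def split: if_splits)
qed

lemma halfspace_eq_imp:
  assumes I: "sectors I" and J: "sectors J" and eq: "halfspace a I = halfspace b J"
  shows "I = J" and "proj a = proj b"
proof -
  obtain i0 j0 where i0: "i0 \<in> I" and j0: "j0 \<notin> I" using I by (auto simp: sectors_def)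
  obtain i1 j1 where i1: "i1 \<in> J" and j1: "j1 \<notin> J" using J by (auto simp: sectors_def)
  have "I \<subseteq> J" using halfspace_subset_apex_le(1)[OF I J _ _ j0] eq by blast
  moreover have "J \<subseteq> I" using halfspace_subset_apex_le(1)[OF J I _ _ j1] eq by blast
  ultimately show IJ: "I = J" by blast
  have d: "a $ i - b $ i = a $ j - b $ j" if "i \<in> I" "j \<notin> I" for i j
    using halfspace_subset_apex_le(2)[OF I J _ that, of a b]
      halfspace_subset_apex_le(2)[OF J I, of b a i j] eq that IJ by simp
  have "b $ k = (b $ i0 - a $ i0) + a $ k" for k
    using d[of k j0] d[OF i0 j0] d[OF i0, of k] j0 by (cases "k \<in> I") auto
  then have "same_upto_const a b" unfolding same_upto_const_def by blast
  then show "proj a = proj b" by (simp add: tproj.abs_eq_iff)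
qed

lemma apex_halfspace: "sectors I \<Longrightarrow> apex (halfspace a I) = proj a"
  unfolding apex_def by (rule the_equality) (use halfspace_eq_imp(2) in blast)+

section \<open>External representations\<close>

text \<open>Half-spaces do not contain the vector with all coordinates \<open>-\<infinity>\<close>, whereas cones do; hence
  \<^term>\<open>C \<inter> rmax_nonzero\<close> is what is compared with half-spaces below.\<close>

definition inter_halfspaces :: "(ereal^'n::finite) set set \<Rightarrow> (ereal^'n) set" where
  "inter_halfspaces \<Gamma> = {x \<in> rmax_nonzero. \<forall>H\<in>\<Gamma>. x \<in> H}"

definition Sigma_all :: "(ereal^'n::finite) set \<Rightarrow> (ereal^'n) set set" where
  "Sigma_all C = {halfspace a I | a I.
     sectors I \<and> C \<inter> rmax_nonzero \<subseteq> halfspace a I \<and> proj a \<in> proj_image C}"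

definition Sigma_at :: "(ereal^'n::finite) set \<Rightarrow> 'n tproj \<Rightarrow> (ereal^'n) set set" where
  "Sigma_at C q = {halfspace a I | a I.
     sectors I \<and> C \<inter> rmax_nonzero \<subseteq> halfspace a I \<and> proj a = q}"

definition tau :: "(ereal^'n::finite) set \<Rightarrow> (ereal^'n) set set \<Rightarrow> (ereal^'n) set set" where
  "tau C \<Gamma> = (if \<Gamma> = {} then {} else {H \<in> Sigma_all C. inter_halfspaces \<Gamma> \<subseteq> H})"

definition nonredundant_external_representation ::
    "(ereal^'n::finite) set \<Rightarrow> (ereal^'n) set set \<Rightarrow> bool" where
  "nonredundant_external_representation C \<Gamma> \<longleftrightarrow>
     finite \<Gamma> \<and> \<Gamma> \<subseteq> Sigma_all C \<and>
     inter_halfspaces \<Gamma> = C \<inter> rmax_nonzero \<and>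
     (\<forall>H\<in>\<Gamma>. H \<notin> tau C (\<Gamma> - {H}))"

definition tau' :: "(ereal^'n::finite) set \<Rightarrow> 'n tproj set \<Rightarrow> 'n tproj set" where
  "tau' C X = {q \<in> cone_boundary C. Sigma_at C q \<subseteq> tau C (\<Union>b\<in>X. Sigma_at C b)}"

definition finite_generating :: "(ereal^'n::finite) set \<Rightarrow> 'n tproj set \<Rightarrow> bool" where
  "finite_generating C X \<longleftrightarrow> finite X \<and> X \<subseteq> cone_boundary C \<and> tau' C X = cone_boundary C"

definition minimal_apex_set :: "(ereal^'n::finite) set \<Rightarrow> 'n tproj set" where
  "minimal_apex_set C =
     (THE X. finite_generating C X \<and> (\<forall>Y. finite_generating C Y \<and> Y \<subseteq> X \<longrightarrow> Y = X))"

end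

theory Submission
  imports Defs
begin

text \<open>
  The apices of \<open>\<Gamma>\<close> form the least finite generating set, which makes \<open>\<A>\<close> well defined as well.
  Suppose that \<open>H(a, I) \<in> \<Gamma>\<close> and that \<open>X\<close> is generating but does not contain \<open>a\<close>.  Non-redundancy
  provides a point of all other members of \<open>\<Gamma>\<close> outside \<open>H(a, I)\<close>; moving from it along the tropical
  segment towards \<open>a\<close> gives such a point \<open>x\<close> with \<open>a \<le> x \<le> a + \<epsilon>\<close>, for \<open>\<epsilon> > 0\<close> as small as we wish.
  For \<open>b \<in> X\<close> put \<open>\<mu> = max (b - a)\<close> and \<open>y = x \<oplus> (\<epsilon> - \<mu>) b\<close>.  Then \<open>y\<close> lies in the other members of
  \<open>\<Gamma>\<close> because \<open>x\<close> and \<open>b\<close> do, and in \<open>H(a, I)\<close> because the maximum of \<open>b - a\<close> is attained on \<open>I\<close>.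
  Hence \<open>y \<in> C\<close>, so \<open>y\<close> lies in every \<open>H(b, J)\<close> containing \<open>C\<close>.  As \<open>y - b = max (x - b) (\<epsilon> - \<mu>)\<close> and
  \<open>\<epsilon> - \<mu> \<le> max (a - b)\<close>, also \<open>x \<in> H(b, J)\<close>.  Thus \<open>x\<close> contradicts that \<open>X\<close> is generating.
\<close>

section \<open>Tropical half-spaces and points close to an apex\<close>

lemma ereal_vec_nth [simp]: "ereal_vec a $ i = ereal (a $ i)"
  by (simp add: ereal_vec_def)

lemma ereal_vec_in_rmax_nonzero [simp]: "ereal_vec a \<in> rmax_nonzero"
  by (simp add: rmax_nonzero_def)

lemma ereal_vec_in_halfspace_iff:
  assumes "sectors I"
  shows "ereal_vec x \<in> halfspace a I \<longleftrightarrow> (\<forall>j. j \<notin> I \<longrightarrow> (\<exists>i\<in>I. x $ j - a $ j \<le> x $ i - a $ i))"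
  using assms by (simp add: mem_halfspace_iff)

lemma halfspace_shift:
  assumes "sectors I" "x \<in> halfspace a I"
  shows "(\<chi> i. x $ i + ereal c) \<in> halfspace a I"
proof -
  have "u + ereal c - ereal s \<le> v + ereal c - ereal t" if "u - ereal s \<le> v - ereal t" for u v s t
    using that by (cases u; cases v) auto
  moreover have "(\<chi> i. x $ i + ereal c) \<in> rmax_nonzero"
    using assms by (auto simp: mem_halfspace_iff rmax_nonzero_def)
  ultimately show ?thesis
    using assms unfolding mem_halfspace_iff[OF assms(1)] by (simp, blast)
qed

lemma halfspace_max:
  assumes I: "sectors I" and x: "x \<in> halfspace a I" and y: "y \<in> halfspace a I"
  shows "(\<chi> i. max (x $ i) (y $ i)) \<in> halfspace a I"
proof -
  have "\<exists>i\<in>I. max (x $ j) (y $ j) - ereal (a $ j) \<le> max (x $ i) (y $ i) - ereal (a $ i)"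
    if "j \<notin> I" for j
  proof -
    have mono: "u - ereal s \<le> w - ereal s" if "u \<le> w" for u w s
      using that by (simp add: ereal_minus_mono)
    obtain i where i: "i \<in> I" "x $ j - ereal (a $ j) \<le> x $ i - ereal (a $ i)"
      using x that by (auto simp: mem_halfspace_iff[OF I])
    obtain k where k: "k \<in> I" "y $ j - ereal (a $ j) \<le> y $ k - ereal (a $ k)"
      using y that by (auto simp: mem_halfspace_iff[OF I])
    show ?thesis
    proof (cases "y $ j \<le> x $ j")
      case True
      then show ?thesis
        using i mono[of "x $ i" "max (x $ i) (y $ i)" "a $ i"]
        by (intro bexI[of _ i]) (auto simp: max_absorb1 intro: order_trans)
    next
      case False
      then show ?thesis
        using k mono[of "y $ k" "max (x $ k) (y $ k)" "a $ k"]
        by (intro bexI[of _ k]) (auto simp: max_absorb2 intro: order_trans)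
    qed
  qed
  moreover have "(\<chi> i. max (x $ i) (y $ i)) \<in> rmax_nonzero"
    using x y by (auto simp: mem_halfspace_iff[OF I] rmax_nonzero_def max_def)
  ultimately show ?thesis
    by (simp add: mem_halfspace_iff[OF I])
qed

text \<open>An anti-exchange property. Since \<open>\<epsilon>\<close> is at most the spread of
  \<open>b - a\<close>, some shift of \<open>b\<close> can be added to \<open>x\<close> so as to
  enter \<open>H(a, I)\<close> without raising any entry of \<open>x - b\<close> above one already
  present on \<open>J\<close>. So if the result lies in \<open>H(b, J)\<close>, then
  \<open>x\<close> does.\<close>

lemma halfspace_no_exchange:
  fixes a b x :: "real^'n::finite"
  assumes I: "sectors I" and J: "sectors J"
    and b_in: "ereal_vec b \<in> halfspace a I" and a_in: "ereal_vec a \<in> halfspace b J"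
    and x: "\<And>i. a $ i \<le> x $ i" "\<And>i. x $ i \<le> a $ i + \<epsilon>"
    and \<epsilon>: "\<epsilon> \<le> (b $ k - a $ k) - (b $ l - a $ l)"
    and imp: "\<And>c. ereal_vec (\<chi> i. max (x $ i) (b $ i + c)) \<in> halfspace a I \<Longrightarrow>
                    ereal_vec (\<chi> i. max (x $ i) (b $ i + c)) \<in> halfspace b J"
  shows "ereal_vec x \<in> halfspace b J"
proof (rule ccontr)
  assume "ereal_vec x \<notin> halfspace b J"
  then obtain j where j: "j \<notin> J" "\<And>i. i \<in> J \<Longrightarrow> x $ i - b $ i < x $ j - b $ j"
    unfolding ereal_vec_in_halfspace_iff[OF J] by force
  define \<mu> where "\<mu> = (MAX i. b $ i - a $ i)"
  have \<mu>: "b $ i - a $ i \<le> \<mu>" for i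
    unfolding \<mu>_def by (rule Max_ge) auto
  have "\<mu> \<in> range (\<lambda>i. b $ i - a $ i)"
    unfolding \<mu>_def by (rule Max_in) auto
  then obtain m where m: "\<mu> = b $ m - a $ m" by auto
  \<comment> \<open>As \<open>b\<close> lies in \<open>H(a, I)\<close>, a maximiser of
    \<open>b - a\<close> outside \<open>I\<close> is matched by one inside.\<close>
  obtain i0 where i0: "i0 \<in> I" "b $ i0 - a $ i0 = \<mu>"
  proof (cases "m \<in> I")
    case False
    then obtain i where "i \<in> I" "\<mu> \<le> b $ i - a $ i"
      using b_in m unfolding ereal_vec_in_halfspace_iff[OF I] by auto
    then show ?thesis using that \<mu>[of i] by force
  qed (use m that in auto)
  \<comment> \<open>The shift \<open>\<epsilon> - \<mu>\<close> lets \<open>b\<close> reach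
    \<open>a + \<epsilon>\<close> at \<open>i0\<close> without exceeding it anywhere.\<close>
  define y where "y = (\<chi> i. max (x $ i) (b $ i + (\<epsilon> - \<mu>)))"
  have y_le: "y $ i - a $ i \<le> \<epsilon>" for i
    using x(2)[of i] \<mu>[of i] by (simp add: y_def)
  have "\<epsilon> \<le> y $ i0 - a $ i0"
    using i0 by (simp add: y_def)
  then have "ereal_vec y \<in> halfspace a I"
    unfolding ereal_vec_in_halfspace_iff[OF I] using i0 y_le order_trans by blast
  then have "ereal_vec y \<in> halfspace b J"
    unfolding y_def by (rule imp)
  then obtain i where i: "i \<in> J" "y $ j - b $ j \<le> y $ i - b $ i"
    using j unfolding ereal_vec_in_halfspace_iff[OF J] by blast
  \<comment> \<open>The index \<open>l\<close> is moved into \<open>J\<close>, where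
    \<open>x - b\<close> is known to stay below its value at \<open>j\<close>. So
    \<open>\<epsilon> - \<mu>\<close> stays below that value too, and no entry of
    \<open>y - b\<close> on \<open>J\<close> can reach it.\<close>
  obtain i' where i': "i' \<in> J" "a $ l - b $ l \<le> a $ i' - b $ i'"
    using a_in unfolding ereal_vec_in_halfspace_iff[OF J] by (cases "l \<in> J") blast+
  have "\<epsilon> - \<mu> \<le> x $ i' - b $ i'"
    using \<epsilon> \<mu>[of k] i'(2) x(1)[of i'] by linarith
  then show False
    using i j(2)[OF i(1)] j(2)[OF i'(1)] by (auto simp: y_def max_def split: if_splits)
qed

text \<open>Shift \<open>u\<close> until the maximum of \<open>u - a\<close> is
  \<open>\<epsilon>\<close>. That maximum is attained only outside \<open>I\<close>, and as
  \<open>\<epsilon> > 0\<close>, taking the maximum with \<open>a\<close> does not change this. It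
  does make the point real, although \<open>u\<close> may have infinite entries.\<close>

lemma halfspace_approach_apex:
  fixes a :: "real^'n::finite"
  assumes I: "sectors I" and u: "u \<in> rmax_nonzero" "u \<notin> halfspace a I" and \<epsilon>: "0 < \<epsilon>"
  obtains x c where "\<And>i. a $ i \<le> x $ i" "\<And>i. x $ i \<le> a $ i + \<epsilon>"
    "ereal_vec x = (\<chi> i. max (ereal (a $ i)) (u $ i + ereal c))" "ereal_vec x \<notin> halfspace a I"
proof -
  define M where "M = (MAX i. u $ i - ereal (a $ i))"
  have M: "u $ i - ereal (a $ i) \<le> M" for i
    unfolding M_def by (rule Max_ge) auto
  have "M \<in> range (\<lambda>i. u $ i - ereal (a $ i))"
    unfolding M_def by (rule Max_in) auto
  then obtain m where m: "M = u $ m - ereal (a $ m)" by auto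
  obtain j where j: "j \<notin> I" "\<And>i. i \<in> I \<Longrightarrow> u $ i - ereal (a $ i) < u $ j - ereal (a $ j)"
    using u unfolding mem_halfspace_iff[OF I] by force
  have mI: "m \<notin> I"
    using j(2)[of m] M[of j] m by auto
  have less: "u $ i - ereal (a $ i) < M" if "i \<in> I" for i
    using j(2)[OF that] M[of j] by auto
  have fin: "u $ i \<noteq> \<infinity>" for i
    using u by (auto simp: rmax_nonzero_def)
  have "\<bar>M\<bar> \<noteq> \<infinity>"
  proof -
    obtain i where "u $ i \<noteq> -\<infinity>" using u by (auto simp: rmax_nonzero_def)
    then have "M \<noteq> -\<infinity>" using M[of i] by (cases "u $ i") auto
    moreover have "M \<noteq> \<infinity>" using fin[of m] by (cases "u $ m") (auto simp: m)
    ultimately show ?thesis by auto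
  qed
  then obtain r where r: "M = ereal r" by auto
  \<comment> \<open>\<open>real_of_ereal\<close> loses nothing: the entries of \<open>a\<close> are
    real and those of \<open>u\<close> are not \<open>\<infinity>\<close>.\<close>
  define x where "x = (\<chi> i. real_of_ereal (max (ereal (a $ i)) (u $ i + ereal (\<epsilon> - r))))"
  have x_eq: "ereal (x $ i) = max (ereal (a $ i)) (u $ i + ereal (\<epsilon> - r))" for i
    using fin[of i] by (cases "u $ i") (auto simp: x_def max_def)
  have lo: "a $ i \<le> x $ i" for i
    using x_eq[of i] by (metis ereal_less_eq(3) max.cobounded1)
  have hi: "x $ i \<le> a $ i + \<epsilon>" for i
    using x_eq[of i] M[of i] fin[of i] r \<epsilon> by (cases "u $ i") (auto simp: max_def split: if_splits)
  have strict: "x $ i < a $ i + \<epsilon>" if "i \<in> I" for i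
    using x_eq[of i] less[OF that] fin[of i] r \<epsilon>
    by (cases "u $ i") (auto simp: max_def split: if_splits)
  have "x $ m = a $ m + \<epsilon>"
    using x_eq[of m] m fin[of m] r \<epsilon> by (cases "u $ m") (auto simp: max_def split: if_splits)
  then have "ereal_vec x \<notin> halfspace a I"
    using mI strict unfolding ereal_vec_in_halfspace_iff[OF I] by force
  moreover have "ereal_vec x = (\<chi> i. max (ereal (a $ i)) (u $ i + ereal (\<epsilon> - r)))"
    by (simp add: vec_eq_iff x_eq)
  ultimately show thesis using that lo hi by blast
qed

lemma proj_rep_tproj [simp]: "proj (rep_tproj q) = q"
  using Quotient3_abs_rep[OF Quotient3_tproj] .

text \<open>The spread \<open>max (b - a) - min (b - a)\<close> depends only on the class of
  \<open>b\<close> and is positive unless that class is \<open>proj a\<close>. So finitely many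
  other classes have a common positive lower bound.\<close>

lemma small_against_spreads:
  fixes a :: "real^'n::finite"
  assumes "finite X" "proj a \<notin> X"
  obtains \<epsilon> where "0 < \<epsilon>"
    "\<And>b. proj b \<in> X \<Longrightarrow> \<exists>k l. \<epsilon> \<le> (b $ k - a $ k) - (b $ l - a $ l)"
proof -
  have "\<exists>s>0. \<forall>b. proj b = q \<longrightarrow> (\<exists>k l. s \<le> (b $ k - a $ k) - (b $ l - a $ l))" if "q \<in> X" for q
  proof -
    obtain b0 where b0: "q = proj b0" by (metis proj_rep_tproj)
    with assms that have "\<not> same_upto_const a b0" by (metis tproj.abs_eq_iff)
    moreover have "same_upto_const a b0" if "\<And>k l. b0 $ k - a $ k \<le> b0 $ l - a $ l"
      unfolding same_upto_const_def
    \<comment> \<open>\<open>undefined\<close> serves as an arbitrary fixed index.\<close>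
    proof (intro exI allI)
      fix i show "b0 $ i = (b0 $ undefined - a $ undefined) + a $ i"
        using that[of i undefined] that[of undefined i] by simp
    qed
    ultimately obtain k l where kl: "b0 $ l - a $ l < b0 $ k - a $ k"
      by (meson not_less)
    have "(b0 $ k - a $ k) - (b0 $ l - a $ l) \<le> (b $ k - a $ k) - (b $ l - a $ l)"
      if "proj b = q" for b
    proof -
      have "same_upto_const b b0"
        using that b0 by (simp add: tproj.abs_eq_iff)
      then obtain c where "\<forall>i. b0 $ i = c + b $ i"
        by (auto simp: same_upto_const_def)
      then show ?thesis by simp
    qed
    then show ?thesis
      using kl by (intro exI[of _ "(b0 $ k - a $ k) - (b0 $ l - a $ l)"] conjI) (simp, blast)
  qed
  then obtain s where s: "\<And>q. q \<in> X \<Longrightarrow> 0 < s q"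
    "\<And>b. proj b \<in> X \<Longrightarrow> \<exists>k l. s (proj b) \<le> (b $ k - a $ k) - (b $ l - a $ l)"
    by metis
  show thesis
  proof (rule that)
    \<comment> \<open>The inserted 1 covers the case of empty \<open>X\<close>.\<close>
    show "0 < Min (insert 1 (s ` X))"
      using assms s(1) by (subst Min_gr_iff) auto
    fix b assume b: "proj b \<in> X"
    then have "Min (insert 1 (s ` X)) \<le> s (proj b)"
      using assms by (intro Min_le) auto
    then show "\<exists>k l. Min (insert 1 (s ` X)) \<le> (b $ k - a $ k) - (b $ l - a $ l)"
      using s(2)[OF b] order_trans by blast
  qed
qed

section \<open>The cone and its boundary in projective space\<close>

lemma Sigma_allE:
  assumes "H \<in> Sigma_all C"
  obtains a I where "sectors I" "C \<inter> rmax_nonzero \<subseteq> halfspace a I" "proj a \<in> proj_image C"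
    "H = halfspace a I"
proof -
  from assms have "\<exists>a I. H = halfspace a I \<and> sectors I \<and> C \<inter> rmax_nonzero \<subseteq> halfspace a I \<and>
      proj a \<in> proj_image C"
    unfolding Sigma_all_def by (rule CollectD)
  then show thesis using that by (elim exE conjE)
qed

lemma inter_halfspaces_shift:
  assumes "\<Gamma> \<subseteq> Sigma_all C" "x \<in> inter_halfspaces \<Gamma>"
  shows "(\<chi> i. x $ i + ereal c) \<in> inter_halfspaces \<Gamma>"
proof -
  have "(\<chi> i. x $ i + ereal c) \<in> rmax_nonzero"
    using assms by (auto simp: inter_halfspaces_def rmax_nonzero_def)
  then show ?thesis
    using assms halfspace_shift[of _ x _ c] by (force simp: inter_halfspaces_def Sigma_all_def)
qed

text \<open>\<open>proj_image\<close> asks for one representative in \<open>C\<close>. Shift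
  invariance of the half-spaces passes membership on to all of them.\<close>

lemma proj_in_proj_image_iff:
  assumes \<Gamma>: "\<Gamma> \<subseteq> Sigma_all C" and eq: "inter_halfspaces \<Gamma> = C \<inter> rmax_nonzero"
  shows "proj a \<in> proj_image C \<longleftrightarrow> ereal_vec a \<in> C"
proof
  assume "proj a \<in> proj_image C"
  then obtain b where b: "proj b = proj a" "ereal_vec b \<in> C" by (auto simp: proj_image_def)
  then obtain c where "\<forall>i. a $ i = c + b $ i" by (metis tproj.abs_eq_iff same_upto_const_def)
  then have "ereal_vec a = (\<chi> i. ereal_vec b $ i + ereal c)"
    by (simp add: vec_eq_iff)
  also have "\<dots> \<in> inter_halfspaces \<Gamma>"
    using b eq by (intro inter_halfspaces_shift[OF \<Gamma>]) auto
  finally show "ereal_vec a \<in> C" using eq by blast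
qed (auto simp: proj_image_def)

text \<open>Closedness puts the boundary inside the image, so that boundary points are admissible
  apices. The preimage in real space is cut out by weak inequalities.\<close>

lemma closed_proj_image:
  fixes C :: "(ereal^'n::finite) set"
  assumes \<Gamma>: "\<Gamma> \<subseteq> Sigma_all C" and eq: "inter_halfspaces \<Gamma> = C \<inter> rmax_nonzero"
  shows "closed (proj_image C)"
proof -
  have "closed {x. ereal_vec x \<in> H}" if "H \<in> \<Gamma>" for H
  proof -
    obtain a I where "sectors I" "H = halfspace a I"
      using Sigma_allE[OF subsetD[OF \<Gamma> \<open>H \<in> \<Gamma>\<close>]] by metis
    then have "{x. ereal_vec x \<in> H} =
        (\<Inter>j\<in>- I. \<Union>i\<in>I. {x. x $ j - a $ j \<le> x $ i - a $ i})"
      by (auto simp: ereal_vec_in_halfspace_iff)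
    also have "closed \<dots>"
      by (intro closed_INT closed_UN ballI closed_Collect_le continuous_intros) auto
    finally show ?thesis .
  qed
  then have "closed (\<Inter>H\<in>\<Gamma>. {x. ereal_vec x \<in> H})" by blast
  moreover have "(\<Inter>H\<in>\<Gamma>. {x. ereal_vec x \<in> H}) = {x. ereal_vec x \<in> inter_halfspaces \<Gamma>}"
    by (auto simp: inter_halfspaces_def)
  moreover have "\<dots> = proj -` proj_image C"
    using eq proj_in_proj_image_iff[OF \<Gamma> eq] by auto
  ultimately show ?thesis
    by (simp add: closed_def open_tproj_def vimage_Compl)
qed

text \<open>Raising an entry of the apex outside \<open>I\<close>, however slightly, leaves the
  half-space and hence \<open>C\<close>.\<close>

lemma apex_in_cone_boundary:
  fixes C :: "(ereal^'n::finite) set"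
  assumes \<Gamma>: "\<Gamma> \<subseteq> Sigma_all C" and eq: "inter_halfspaces \<Gamma> = C \<inter> rmax_nonzero"
    and H: "H \<in> Sigma_all C"
  shows "apex H \<in> cone_boundary C"
proof -
  obtain a I where I: "sectors I" and sub: "C \<inter> rmax_nonzero \<subseteq> halfspace a I"
    and a: "proj a \<in> proj_image C" and H_eq: "H = halfspace a I"
    using H by (rule Sigma_allE)
  obtain j where j: "j \<notin> I" using I by (auto simp: sectors_def)
  have "proj a \<notin> interior (proj_image C)"
  proof
    assume "proj a \<in> interior (proj_image C)"
    then obtain U where U: "open U" "proj a \<in> U" "U \<subseteq> proj_image C"
      by (auto simp: interior_def)
    then have "open (proj -` U)" "a \<in> proj -` U" by (simp_all add: open_tproj_def)
    then obtain e where e: "e > 0" "ball a e \<subseteq> proj -` U"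
      by (meson open_contains_ball)
    define x where "x = a + (e / 2) *\<^sub>R axis j 1"
    have "x \<in> ball a e"
      using e by (simp add: x_def dist_norm)
    then have "ereal_vec x \<in> C"
      using e U proj_in_proj_image_iff[OF \<Gamma> eq] by blast
    then have "ereal_vec x \<in> halfspace a I" using sub by auto
    then obtain i where "i \<in> I" "x $ j - a $ j \<le> x $ i - a $ i"
      using j unfolding ereal_vec_in_halfspace_iff[OF I] by blast
    then show False
      using e j by (auto simp: x_def axis_def split: if_splits)
  qed
  then show ?thesis
    using a closure_subset[of "proj_image C"]
    by (auto simp: cone_boundary_def frontier_def H_eq apex_halfspace[OF I])
qed

section \<open>The apices of a representation as the least generating set\<close>

lemma Sigma_all_in_Sigma_at_apex:
  assumes "H \<in> Sigma_all C"
  shows "H \<in> Sigma_at C (apex H)"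
  using assms
proof (rule Sigma_allE)
  fix a I
  assume "sectors I" "C \<inter> rmax_nonzero \<subseteq> halfspace a I" "H = halfspace a I"
  then show ?thesis
    unfolding Sigma_at_def by (intro CollectI exI[of _ a] exI[of _ I]) (simp add: apex_halfspace)
qed

lemma Sigma_at_subset_Sigma_all: "q \<in> proj_image C \<Longrightarrow> Sigma_at C q \<subseteq> Sigma_all C"
  unfolding Sigma_all_def Sigma_at_def by blast

text \<open>The half-spaces at these apices include \<open>\<Gamma>\<close>, so their intersection
  lies in \<open>C\<close> and thus in every half-space containing \<open>C\<close>.\<close>

lemma apices_generating:
  fixes C :: "(ereal^'n::finite) set"
  assumes fin: "finite \<Gamma>" and \<Gamma>: "\<Gamma> \<subseteq> Sigma_all C"
    and eq: "inter_halfspaces \<Gamma> = C \<inter> rmax_nonzero"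
  shows "finite_generating C (apex ` \<Gamma>)"
proof -
  have "H \<in> tau C (\<Union>b\<in>apex ` \<Gamma>. Sigma_at C b)"
    if q: "q \<in> cone_boundary C" and H: "H \<in> Sigma_at C q" for q H
  proof -
    have sub: "\<Gamma> \<subseteq> (\<Union>b\<in>apex ` \<Gamma>. Sigma_at C b)"
    proof
      fix K assume K: "K \<in> \<Gamma>"
      show "K \<in> (\<Union>b\<in>apex ` \<Gamma>. Sigma_at C b)"
      proof (rule UN_I)
        show "apex K \<in> apex ` \<Gamma>" by (rule imageI[OF K])
        show "K \<in> Sigma_at C (apex K)"
          by (rule Sigma_all_in_Sigma_at_apex[OF subsetD[OF \<Gamma> K]])
      qed
    qed
    \<comment> \<open>\<open>tau\<close> of the empty set is empty, so this case must be excluded: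
      there \<open>C\<close> would be the whole space and have no boundary point
      \<open>q\<close>.\<close>
    have "\<Gamma> \<noteq> {}"
    proof
      assume "\<Gamma> = {}"
      then have "ereal_vec x \<in> inter_halfspaces \<Gamma>" for x
        by (simp add: inter_halfspaces_def)
      then have "ereal_vec x \<in> C" for x
        unfolding eq by blast
      then have "proj (rep_tproj p) \<in> proj_image C" for p
        unfolding proj_in_proj_image_iff[OF \<Gamma> eq] .
      then have "proj_image C = UNIV" by auto
      then show False using q by (simp add: cone_boundary_def)
    qed
    moreover have "inter_halfspaces (\<Union>b\<in>apex ` \<Gamma>. Sigma_at C b) \<subseteq> H"
    proof -
      have "inter_halfspaces (\<Union>b\<in>apex ` \<Gamma>. Sigma_at C b) \<subseteq> inter_halfspaces \<Gamma>"
        using sub by (auto simp: inter_halfspaces_def)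
      also have "\<dots> \<subseteq> H"
        using H eq by (auto simp: Sigma_at_def)
      finally show ?thesis .
    qed
    moreover have "H \<in> Sigma_all C"
      using q H closed_proj_image[OF \<Gamma> eq] Sigma_at_subset_Sigma_all
      by (auto simp: cone_boundary_def frontier_def)
    ultimately show ?thesis
      using sub by (auto simp: tau_def)
  qed
  then show ?thesis
    using fin \<Gamma> apex_in_cone_boundary[OF \<Gamma> eq]
    by (auto simp: finite_generating_def tau'_def)
qed

lemma nonredundant_apex_in_generating:
  fixes C :: "(ereal^'n::finite) set"
  assumes \<Gamma>: "\<Gamma> \<subseteq> Sigma_all C" and eq: "inter_halfspaces \<Gamma> = C \<inter> rmax_nonzero"
    and H: "H \<in> \<Gamma>" and nonred: "H \<notin> tau C (\<Gamma> - {H})"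
    and X: "finite_generating C X"
  shows "apex H \<in> X"
proof (rule ccontr)
  assume "apex H \<notin> X"
  obtain a I where I: "sectors I" and sub: "C \<inter> rmax_nonzero \<subseteq> halfspace a I"
    and a: "proj a \<in> proj_image C" and H_eq: "H = halfspace a I"
    using subsetD[OF \<Gamma> H] by (rule Sigma_allE)
  have apex_H: "apex H = proj a" by (simp add: H_eq apex_halfspace[OF I])
  have aC: "ereal_vec a \<in> C" using a proj_in_proj_image_iff[OF \<Gamma> eq] by blast
  \<comment> \<open>If \<open>H\<close> is the only member, non-redundancy says nothing, since
    \<open>tau C {}\<close> is empty by convention. Any point outside \<open>H\<close> then
    serves.\<close>
  have "\<exists>u\<in>rmax_nonzero. u \<notin> H \<and> (\<forall>H'\<in>\<Gamma> - {H}. u \<in> H')"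
  proof (cases "\<Gamma> - {H} = {}")
    case True
    obtain j where "j \<notin> I" using I by (auto simp: sectors_def)
    then have "ereal_vec (a + axis j 1) \<notin> H"
      by (auto simp: H_eq ereal_vec_in_halfspace_iff[OF I] axis_def)
    then show ?thesis using True by (intro bexI[of _ "ereal_vec (a + axis j 1)"]) auto
  next
    case False
    then have "\<not> inter_halfspaces (\<Gamma> - {H}) \<subseteq> H"
      using nonred H \<Gamma> unfolding tau_def by auto
    then show ?thesis by (auto simp: inter_halfspaces_def)
  qed
  then obtain u where u: "u \<in> rmax_nonzero" "u \<notin> H" "\<And>H'. H' \<in> \<Gamma> \<Longrightarrow> H' \<noteq> H \<Longrightarrow> u \<in> H'"
    by blast
  obtain \<epsilon> where \<epsilon>: "0 < \<epsilon>" "\<And>b. proj b \<in> X \<Longrightarrow> \<exists>k l. \<epsilon> \<le> (b $ k - a $ k) - (b $ l - a $ l)"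
    using small_against_spreads[of X a] X \<open>apex H \<notin> X\<close> apex_H by (auto simp: finite_generating_def)
  obtain x c where x: "\<And>i. a $ i \<le> x $ i" "\<And>i. x $ i \<le> a $ i + \<epsilon>"
    and x_eq: "ereal_vec x = (\<chi> i. max (ereal (a $ i)) (u $ i + ereal c))"
    and xH: "ereal_vec x \<notin> H"
    using halfspace_approach_apex[OF I u(1) u(2)[unfolded H_eq] \<epsilon>(1)] unfolding H_eq by blast
  have Gamma_sup: "C \<inter> rmax_nonzero \<subseteq> H'" if "H' \<in> \<Gamma>" for H'
    using that \<Gamma> by (auto simp: Sigma_all_def)
  \<comment> \<open>\<open>x\<close> is the maximum of a point of \<open>C\<close> and a shift of
    \<open>u\<close>, and half-spaces are closed under both operations.\<close>
  have x_in: "ereal_vec x \<in> H'" if H': "H' \<in> \<Gamma>" "H' \<noteq> H" for H'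
  proof -
    obtain b J where J: "sectors J" "H' = halfspace b J"
      using Sigma_allE[OF subsetD[OF \<Gamma> H'(1)]] by metis
    have "ereal_vec a \<in> H'" using Gamma_sup[OF H'(1)] aC by auto
    then show ?thesis
      using halfspace_max[OF J(1) _ halfspace_shift[OF J(1)], of "ereal_vec a" b u c] u(3)[OF H']
      by (simp add: x_eq J(2))
  qed
  have "ereal_vec x \<in> halfspace b J"
    if b: "proj b \<in> X" and J: "sectors J" and subJ: "C \<inter> rmax_nonzero \<subseteq> halfspace b J" for b J
  proof -
    have "proj b \<in> proj_image C"
      using b X closed_proj_image[OF \<Gamma> eq]
      by (auto simp: finite_generating_def cone_boundary_def frontier_def)
    then have bC: "ereal_vec b \<in> C" using proj_in_proj_image_iff[OF \<Gamma> eq] by blast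
    obtain k l where kl: "\<epsilon> \<le> (b $ k - a $ k) - (b $ l - a $ l)" using \<epsilon>(2)[OF b] by blast
    show ?thesis
    proof (rule halfspace_no_exchange[OF I J _ _ x kl])
      show "ereal_vec b \<in> halfspace a I" using bC sub by auto
      show "ereal_vec a \<in> halfspace b J" using aC subJ by auto
    next
      \<comment> \<open>The other members of \<open>\<Gamma>\<close> contain \<open>x\<close> and
        \<open>b\<close>, hence \<open>y\<close>. Once \<open>H\<close> contains \<open>y\<close> as
        well, \<open>y\<close> belongs to \<open>C\<close> and so to \<open>H(b, J)\<close>.\<close>
      fix d
      define y where "y = (\<chi> i. max (x $ i) (b $ i + d))"
      assume yH: "ereal_vec (\<chi> i. max (x $ i) (b $ i + d)) \<in> halfspace a I"
      have y_eq: "ereal_vec y = (\<chi> i. max (ereal_vec x $ i) ((\<chi> i. ereal_vec b $ i + ereal d) $ i))"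
        by (auto simp: y_def vec_eq_iff max_def)
      have "ereal_vec y \<in> H'" if H': "H' \<in> \<Gamma>" for H'
      proof (cases "H' = H")
        case True
        then show ?thesis using yH by (simp add: y_def H_eq)
      next
        case False
        obtain b' J' where J': "sectors J'" "H' = halfspace b' J'"
          using Sigma_allE[OF subsetD[OF \<Gamma> H']] by metis
        have "ereal_vec b \<in> H'" using Gamma_sup[OF H'] bC by auto
        then show ?thesis
          unfolding y_eq J'(2)
          by (intro halfspace_max halfspace_shift J'(1)) (use x_in[OF H' False] J'(2) in simp_all)
      qed
      then have "ereal_vec y \<in> C \<inter> rmax_nonzero"
        unfolding eq[symmetric] by (simp add: inter_halfspaces_def)
      then show "ereal_vec (\<chi> i. max (x $ i) (b $ i + d)) \<in> halfspace b J"
        using subJ by (auto simp: y_def)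
    qed
  qed
  then have "ereal_vec x \<in> inter_halfspaces (\<Union>b\<in>X. Sigma_at C b)"
    by (auto simp: inter_halfspaces_def Sigma_at_def)
  \<comment> \<open>The apex of \<open>H\<close> is a boundary point, so \<open>X\<close> must
    generate \<open>H\<close>. Then \<open>H\<close> would contain \<open>x\<close>.\<close>
  moreover have "H \<in> tau C (\<Union>b\<in>X. Sigma_at C b)"
  proof -
    have "H \<in> Sigma_all C" using H \<Gamma> by blast
    then have "apex H \<in> tau' C X" "H \<in> Sigma_at C (apex H)"
      using X apex_in_cone_boundary[OF \<Gamma> eq] Sigma_all_in_Sigma_at_apex
      by (auto simp: finite_generating_def)
    then show ?thesis by (auto simp: tau'_def)
  qed
  ultimately show False
    using xH by (auto simp: tau_def split: if_splits)
qed

theorem theorem5: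
  fixes C :: "(ereal^'n::finite) set" and \<Gamma> :: "(ereal^'n) set set"
  assumes "real_polyhedral_cone C"
    and "nonredundant_external_representation C \<Gamma>"
  shows "minimal_apex_set C = {apex H | H. H \<in> \<Gamma>}"
proof -
  have gen: "finite_generating C (apex ` \<Gamma>)"
    using assms(2) by (auto simp: nonredundant_external_representation_def intro: apices_generating)
  have least: "apex ` \<Gamma> \<subseteq> X" if "finite_generating C X" for X
    using assms(2) that nonredundant_apex_in_generating
    unfolding nonredundant_external_representation_def by blast
  \<comment> \<open>A least generating set is the only minimal one, which gives the uniqueness
    demanded by \<open>THE\<close>.\<close>
  have "minimal_apex_set C = apex ` \<Gamma>"
    unfolding minimal_apex_set_def using gen least by (intro the_equality) blast+
  then show ?thesis by blast
qed

end
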